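(* Let $n\geq 3$ and let $G=L(C_n\circ K_1)$ be the line graph of $C_n\circ K_1$, which has order $n(G)=2n$. Then $$sn(G\circ K_1)=2n=n(G).$$
   Context: All graphs are finite, undirected, simple and connected; the order of a graph is its number of vertices. $\chi(G)$ is the chromatic number. $C_n$ is the cycle on $n$ vertices. Sudoku number: let $\chi(G)=k$ and fix the set of $k$ colors $\{1,\dots,k\}$. For $S\subset V(G)$ let $C_0$ be a proper coloring of the induced subgraph $G[S]$ with colors from these $k$ colors (at most $k$ colors are used). $C_0$ is called extendable if it can be extended to a proper coloring of $G$ with these $k$ colors, and it is a Sudoku coloring of $G$ if this extension exists and is unique. The Sudoku number $sn(G)$ is the smallest $|S|$ such that $G[S]$ admits a Sudoku coloring. Corona product: $G\circ H$ is obtained from one copy of $G$ and $|V(G)|$ disjoint copies of $H$ by joining the $i$-th vertex of $G$ to every vertex of the $i$-th copy of $H$. *)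

theory Defs
  imports Main "HOL-Library.FuncSet"
begin

text \<open>A finite simple graph is given by its vertex set and its set of edges, each edge being
  a two-element set of vertices.\<close>

record 'a ugraph =
  verts :: "'a set"
  edges :: "'a set set"

definition simple_graph :: "'a ugraph \<Rightarrow> bool" where
  "simple_graph G \<longleftrightarrow> finite (verts G) \<and> (\<forall>e\<in>edges G. e \<subseteq> verts G \<and> card e = 2)"

definition graph_order :: "'a ugraph \<Rightarrow> nat" where
  "graph_order G = card (verts G)"

definition induced_subgraph :: "'a ugraph \<Rightarrow> 'a set \<Rightarrow> 'a ugraph" where
  "induced_subgraph G S = \<lparr>verts = S, edges = {e \<in> edges G. e \<subseteq> S}\<rparr>"

text \<open>Colorings are extensional functions, so that two colorings are equal iff they agree on
  the vertices; this makes the uniqueness in the definition of a Sudoku coloring the intended one.\<close>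

definition proper_coloring :: "'a ugraph \<Rightarrow> nat \<Rightarrow> ('a \<Rightarrow> nat) \<Rightarrow> bool" where
  "proper_coloring G k c \<longleftrightarrow>
     c \<in> verts G \<rightarrow>\<^sub>E {1..k} \<and> (\<forall>u v. {u, v} \<in> edges G \<longrightarrow> c u \<noteq> c v)"

definition chromatic_number :: "'a ugraph \<Rightarrow> nat" where
  "chromatic_number G = (LEAST k. \<exists>c. proper_coloring G k c)"

definition sudoku_coloring :: "'a ugraph \<Rightarrow> 'a set \<Rightarrow> ('a \<Rightarrow> nat) \<Rightarrow> bool" where
  "sudoku_coloring G S c0 \<longleftrightarrow>
     proper_coloring (induced_subgraph G S) (chromatic_number G) c0 \<and>
     (\<exists>!c. proper_coloring G (chromatic_number G) c \<and> restrict c S = c0)"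

definition sudoku_number :: "'a ugraph \<Rightarrow> nat" where
  "sudoku_number G =
     (LEAST m. \<exists>S c0. S \<subseteq> verts G \<and> card S = m \<and> sudoku_coloring G S c0)"

text \<open>The vertex \<open>Inl v\<close> is the vertex \<open>v\<close> of \<open>G\<close>, and \<open>Inr (v, w)\<close> is the vertex \<open>w\<close> in the
  copy of \<open>H\<close> attached to \<open>v\<close>.\<close>

definition corona :: "'a ugraph \<Rightarrow> 'b ugraph \<Rightarrow> ('a + 'a \<times> 'b) ugraph" where
  "corona G H =
     \<lparr>verts = Inl ` verts G \<union> Inr ` (verts G \<times> verts H),
      edges = {{Inl u, Inl v} | u v. {u, v} \<in> edges G}
            \<union> {{Inr (v, x), Inr (v, y)} | v x y. v \<in> verts G \<and> {x, y} \<in> edges H}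
            \<union> {{Inl v, Inr (v, x)} | v x. v \<in> verts G \<and> x \<in> verts H}\<rparr>"

definition line_graph :: "'a ugraph \<Rightarrow> 'a set ugraph" where
  "line_graph G =
     \<lparr>verts = edges G,
      edges = {{e, f} | e f. e \<in> edges G \<and> f \<in> edges G \<and> e \<noteq> f \<and> e \<inter> f \<noteq> {}}\<rparr>"

text \<open>This is a simple graph only for \<open>n \<ge> 3\<close>.\<close>

definition cycle_graph :: "nat \<Rightarrow> nat ugraph" where
  "cycle_graph n = \<lparr>verts = {..<n}, edges = {{i, (i + 1) mod n} | i. i < n}\<rparr>"

definition complete_graph :: "nat \<Rightarrow> nat ugraph" where
  "complete_graph n = \<lparr>verts = {..<n}, edges = {{i, j} | i j. i < n \<and> j < n \<and> i \<noteq> j}\<rparr>"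

lemma simple_graph_cycle_graph:
  assumes "n \<ge> 3"
  shows "simple_graph (cycle_graph n)"
proof -
  have "i \<noteq> Suc i mod n" if "i < n" for i
    using assms that by (cases "Suc i = n") auto
  then show ?thesis
    using assms by (auto simp: simple_graph_def cycle_graph_def card_insert_if)
qed

lemma simple_graph_complete_graph: "simple_graph (complete_graph n)"
  by (auto simp: simple_graph_def complete_graph_def)

lemma simple_graph_corona:
  assumes "simple_graph G" "simple_graph H"
  shows "simple_graph (corona G H)"
proof -
  have "u \<noteq> v \<and> u \<in> verts G \<and> v \<in> verts G" if "{u, v} \<in> edges G" for u v
    using assms(1) that unfolding simple_graph_def by (force simp: card_2_iff)
  moreover have "u \<noteq> v \<and> u \<in> verts H \<and> v \<in> verts H" if "{u, v} \<in> edges H" for u v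
    using assms(2) that unfolding simple_graph_def by (force simp: card_2_iff)
  ultimately show ?thesis
    using assms unfolding simple_graph_def corona_def by (auto simp: card_insert_if)
qed

lemma simple_graph_line_graph:
  assumes "simple_graph G"
  shows "simple_graph (line_graph G)"
proof -
  have "finite (edges G)"
    using assms unfolding simple_graph_def
    by (meson PowI finite_Pow_iff finite_subset subsetI)
  then show ?thesis
    unfolding simple_graph_def line_graph_def by (clarsimp simp: card_2_iff) blast
qed

end

theory Submission
  imports Defs
begin

text \<open>In a graph of chromatic number at least 3 every leaf must be given: a leaf that is not given
  could be recolored. Hence \<open>sn(G \<circ> K\<^sub>1) \<ge> n(G)\<close>, with equality if and only if the leaves alone
  can be colored so that \<open>G\<close> has a unique coloring avoiding, at each vertex, the color of its leaf.
  For \<open>G = L(C\<^sub>n \<circ> K\<^sub>1)\<close> write \<open>e\<^sub>i\<close> for the cycle edges and \<open>f\<^sub>i\<close> for the pendant edges, so that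
  \<open>G\<close> is the union of the triangles \<open>e\<^sub>i\<^sub>-\<^sub>1, e\<^sub>i, f\<^sub>i\<close>. Forbidding color 3 at \<open>e\<^sub>n\<^sub>-\<^sub>1\<close> and \<open>f\<^sub>0\<close> forces
  it at \<open>e\<^sub>0\<close>. Forbidding 1 at \<open>e\<^sub>1\<close> and 3 at \<open>e\<^sub>2, \<dots>, e\<^sub>n\<^sub>-\<^sub>1\<close> then forces the colors 2, 1, 2, \<dots>
  along the cycle, and every \<open>f\<^sub>i\<close> gets the third color of its triangle.\<close>

section \<open>Coronas with \<open>K\<^sub>1\<close> and their proper colorings\<close>

lemma edges_complete_graph_1: "edges (complete_graph 1) = {}"
  by (auto simp: complete_graph_def)

lemma verts_complete_graph_1: "verts (complete_graph 1) = {0}"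
  by (auto simp: complete_graph_def)

lemma verts_corona_complete_graph_1:
  "verts (corona G (complete_graph 1)) = Inl ` verts G \<union> (\<lambda>v. Inr (v, 0)) ` verts G"
  unfolding corona_def verts_complete_graph_1 by auto

lemma edges_corona_complete_graph_1:
  "edges (corona G (complete_graph 1)) =
     {{Inl u, Inl v} | u v. {u, v} \<in> edges G} \<union> {{Inl v, Inr (v, 0)} | v. v \<in> verts G}"
  unfolding corona_def verts_complete_graph_1 edges_complete_graph_1 by auto

text \<open>Since \<open>K\<^sub>1\<close> has no edges, only the edges of \<open>G\<close> and the
  leaf edges remain. As inequality is symmetric, a leaf edge needs to be read in one direction
  only.\<close>

lemma proper_coloring_corona_complete_graph_1_iff:
  "proper_coloring (corona G (complete_graph 1)) k c \<longleftrightarrow>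
     c \<in> verts (corona G (complete_graph 1)) \<rightarrow>\<^sub>E {1..k} \<and>
     (\<forall>u v. {u, v} \<in> edges G \<longrightarrow> c (Inl u) \<noteq> c (Inl v)) \<and>
     (\<forall>v\<in>verts G. c (Inl v) \<noteq> c (Inr (v, 0)))"
proof -
  have "(\<forall>x y. {x, y} \<in> edges (corona G (complete_graph 1)) \<longrightarrow> c x \<noteq> c y) \<longleftrightarrow>
     (\<forall>u v. {u, v} \<in> edges G \<longrightarrow> c (Inl u) \<noteq> c (Inl v)) \<and>
     (\<forall>v\<in>verts G. c (Inl v) \<noteq> c (Inr (v, 0)))" (is "?L \<longleftrightarrow> ?R")
  proof
    assume ?L
    then show ?R
      unfolding edges_corona_complete_graph_1 by blast
  next
    assume R: ?R
    show ?L
      unfolding edges_corona_complete_graph_1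
      using R by (auto simp: doubleton_eq_iff)
        (metis R)+
  qed
  then show ?thesis
    unfolding proper_coloring_def by blast
qed

lemma proper_coloring_corona_case_sum:
  fixes G :: "'a ugraph" and col leaf :: "'a \<Rightarrow> nat"
  defines "H \<equiv> corona G (complete_graph 1)"
  assumes "simple_graph G"
    and "\<And>v. v \<in> verts G \<Longrightarrow> col v \<in> {1..k}"
    and "\<And>u v. {u, v} \<in> edges G \<Longrightarrow> col u \<noteq> col v"
    and "\<And>v. v \<in> verts G \<Longrightarrow> leaf v \<in> {1..k}"
    and "\<And>v. v \<in> verts G \<Longrightarrow> leaf v \<noteq> col v"
  shows "proper_coloring H k (restrict (case_sum col (\<lambda>(v, _). leaf v)) (verts H))"
proof -
  define c where "c = restrict (case_sum col (\<lambda>(v, _). leaf v)) (verts H)"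
  have vH: "verts H = Inl ` verts G \<union> (\<lambda>v. Inr (v, 0)) ` verts G"
    unfolding H_def verts_corona_complete_graph_1 by (rule refl)
  have c: "c (Inl v) = col v" "c (Inr (v, 0)) = leaf v" if "v \<in> verts G" for v
    using that by (auto simp: c_def vH)
  have ends: "u \<in> verts G \<and> v \<in> verts G" if "{u, v} \<in> edges G" for u v
    using assms(2) that unfolding simple_graph_def by force
  have "c \<in> verts H \<rightarrow>\<^sub>E {1..k}"
    unfolding c_def
    by (rule restrict_PiE_iff [THEN iffD2]) (use assms vH in auto)
  then show ?thesis
    unfolding H_def proper_coloring_corona_complete_graph_1_iff c_def[unfolded H_def, symmetric]
    using c ends assms(4,6) by (metis (no_types, lifting))
qed

section \<open>Chromatic number 3 and the Sudoku number of a corona with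
  \<open>K\<^sub>1\<close>\<close>

lemma chromatic_number_eq_3:
  assumes "proper_coloring G 3 c"
    and "u \<in> verts G" "v \<in> verts G" "w \<in> verts G"
    and "{u, v} \<in> edges G" "{v, w} \<in> edges G" "{u, w} \<in> edges G"
  shows "chromatic_number G = 3"
  unfolding chromatic_number_def
proof (rule Least_equality)
  show "\<exists>c. proper_coloring G 3 c"
    using assms(1) by blast
next
  fix k assume "\<exists>d. proper_coloring G k d"
  then obtain d where d: "d \<in> verts G \<rightarrow>\<^sub>E {1..k}"
    and "\<And>x y. {x, y} \<in> edges G \<Longrightarrow> d x \<noteq> d y"
    by (auto simp: proper_coloring_def)
  then have "d u \<noteq> d v" "d v \<noteq> d w" "d u \<noteq> d w"
    using assms(5-7) by simp_all
  then have "card {d u, d v, d w} = 3"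
    by simp
  moreover have "{d u, d v, d w} \<subseteq> {1..k}"
    using assms(2-4) PiE_mem[OF d] by simp
  ultimately show "3 \<le> k"
    using card_mono[of "{1..k}" "{d u, d v, d w}"] by simp
qed

text \<open>A leaf has a single neighbor, so with at least three colors a leaf outside
  \<open>S\<close> could change its color and give a second extension. Hence \<open>S\<close>
  contains all leaves, one for each vertex of \<open>G\<close>.\<close>

lemma graph_order_le_sudoku:
  fixes G :: "'a ugraph"
  defines "H \<equiv> corona G (complete_graph 1)"
  assumes "simple_graph G" "3 \<le> chromatic_number H"
    and S: "S \<subseteq> verts H" "sudoku_coloring H S c0"
  shows "graph_order G \<le> card S"
proof -
  have "finite (verts H)"
    using assms(2) unfolding H_def verts_corona_complete_graph_1 simple_graph_def by blast
  then have finS: "finite S"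
    using S(1) finite_subset by blast
  obtain c where c: "proper_coloring H (chromatic_number H) c" "restrict c S = c0"
    and uniq: "\<And>c'. proper_coloring H (chromatic_number H) c' \<Longrightarrow> restrict c' S = c0 \<Longrightarrow> c' = c"
    using S(2) unfolding sudoku_coloring_def by blast
  have "Inr (v, 0) \<in> S" if v: "v \<in> verts G" for v
  proof (rule ccontr)
    assume nS: "Inr (v, 0) \<notin> S"
    \<comment> \<open>By counting, some color differs both from the color of the leaf and from that
      of its neighbor. Recoloring the leaf with it keeps the coloring proper and leaves
      \<open>S\<close> untouched.\<close>
    have "card {c (Inl v), c (Inr (v, 0))} < card {1..chromatic_number H}"
      using assms(3) by (auto simp: card_insert_if)
    then have "\<not> {1..chromatic_number H} \<subseteq> {c (Inl v), c (Inr (v, 0))}"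
      by (meson card_mono finite.emptyI finite.insertI not_le)
    then obtain a where a: "a \<in> {1..chromatic_number H}" "a \<noteq> c (Inl v)" "a \<noteq> c (Inr (v, 0))"
      by blast
    define c' where "c' = c(Inr (v, 0) := a)"
    have "Inr (v, 0) \<in> verts H"
      using v unfolding H_def verts_corona_complete_graph_1 by blast
    then have "c' \<in> verts H \<rightarrow>\<^sub>E {1..chromatic_number H}"
      using c(1) a(1) unfolding proper_coloring_def c'_def
      by (auto simp: PiE_iff extensional_def)
    then have "proper_coloring H (chromatic_number H) c'"
      using c(1) a(2)
      unfolding H_def proper_coloring_corona_complete_graph_1_iff c'_def by auto
    moreover have "restrict c' S = c0"
      unfolding c(2)[symmetric] using nS by (auto simp: c'_def restrict_def fun_eq_iff)
    ultimately have "c' = c"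
      by (rule uniq)
    then show False
      using a(3) by (metis c'_def fun_upd_same)
  qed
  then have "(\<lambda>v. Inr (v, 0)) ` verts G \<subseteq> S"
    by blast
  then have "card ((\<lambda>v. Inr (v, 0) :: 'a + 'a \<times> nat) ` verts G) \<le> card S"
    using finS card_mono by blast
  then show ?thesis
    by (simp add: graph_order_def card_image inj_on_def)
qed

text \<open>The given vertices are exactly the leaves, and each leaf acts on \<open>G\<close> only
  by forbidding its color at its neighbor. Unique extension thus becomes \<open>uniq\<close>, a list
  coloring condition on \<open>G\<close> alone. Minimality is
  \<open>graph_order_le_sudoku\<close>.\<close>

lemma sudoku_number_corona_complete_graph_1:
  fixes G :: "'a ugraph" and col leaf :: "'a \<Rightarrow> nat"
  defines "H \<equiv> corona G (complete_graph 1)"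
  assumes "simple_graph G"
    and chi: "chromatic_number H = k" "3 \<le> k"
    and col: "\<And>v. v \<in> verts G \<Longrightarrow> col v \<in> {1..k}"
      "\<And>u v. {u, v} \<in> edges G \<Longrightarrow> col u \<noteq> col v"
    and leaf: "\<And>v. v \<in> verts G \<Longrightarrow> leaf v \<in> {1..k}"
      "\<And>v. v \<in> verts G \<Longrightarrow> leaf v \<noteq> col v"
    and uniq: "\<And>d v. \<lbrakk>\<And>v. v \<in> verts G \<Longrightarrow> d v \<in> {1..k}; \<And>v. v \<in> verts G \<Longrightarrow> leaf v \<noteq> d v;
        \<And>u v. {u, v} \<in> edges G \<Longrightarrow> d u \<noteq> d v; v \<in> verts G\<rbrakk> \<Longrightarrow> d v = col v"
  shows "sudoku_number H = graph_order G"
  unfolding sudoku_number_def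
proof (rule Least_equality)
  define S where "S = (\<lambda>v. Inr (v, 0) :: 'a + 'a \<times> nat) ` verts G"
  define c where "c = restrict (case_sum col (\<lambda>(v, _). leaf v)) (verts H)"
  have vH: "verts H = Inl ` verts G \<union> (\<lambda>v. Inr (v, 0)) ` verts G"
    unfolding H_def verts_corona_complete_graph_1 by (rule refl)
  then have SH: "S \<subseteq> verts H"
    by (simp add: S_def)
  have cL: "c (Inl v) = col v" and cR: "c (Inr (v, 0)) = leaf v" if "v \<in> verts G" for v
    using that by (auto simp: c_def vH)
  have proper: "proper_coloring H k c"
    unfolding c_def H_def
    by (rule proper_coloring_corona_case_sum) (fact assms(2) col leaf)+
  have "proper_coloring (induced_subgraph H S) k (restrict c S)"
    using proper SH unfolding proper_coloring_def induced_subgraph_def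
    by (auto simp: PiE_iff subset_iff)
  moreover have "c' = c" if c': "proper_coloring H k c'" "restrict c' S = restrict c S" for c'
  proof -
    have R: "c' (Inr (v, 0)) = leaf v" if "v \<in> verts G" for v
    proof -
      have "Inr (v, 0) \<in> S"
        using that by (simp add: S_def)
      then show ?thesis
        using c'(2) cR[OF that] by (metis restrict_apply')
    qed
    have p: "c' \<in> verts H \<rightarrow>\<^sub>E {1..k}" "\<And>u v. {u, v} \<in> edges G \<Longrightarrow> c' (Inl u) \<noteq> c' (Inl v)"
      "\<And>v. v \<in> verts G \<Longrightarrow> c' (Inl v) \<noteq> c' (Inr (v, 0))"
      using c'(1) unfolding H_def proper_coloring_corona_complete_graph_1_iff by blast+
    \<comment> \<open>On the copy of \<open>G\<close>, any extension \<open>c'\<close> is a coloring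
      that avoids \<open>leaf\<close>, so \<open>uniq\<close> applies to it.\<close>
    have L: "c' (Inl v) = col v" if "v \<in> verts G" for v
    proof (rule uniq[of "\<lambda>v. c' (Inl v)"])
      show "c' (Inl v) \<in> {1..k}" if "v \<in> verts G" for v
        using p(1) that vH by (metis PiE_mem UnCI imageI)
      show "leaf v \<noteq> c' (Inl v)" if "v \<in> verts G" for v
        using p(3)[OF that] R[OF that] by simp
    qed (use p(2) that in auto)
    show ?thesis
    proof (rule PiE_ext[OF p(1)])
      show "c \<in> verts H \<rightarrow>\<^sub>E {1..k}"
        using proper unfolding proper_coloring_def by blast
      show "c' x = c x" if "x \<in> verts H" for x
        using that L R cL cR by (auto simp: vH)
    qed
  qed
  ultimately have "sudoku_coloring H S (restrict c S)"
    using proper unfolding sudoku_coloring_def chi by blast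
  moreover have "card S = graph_order G"
    by (simp add: S_def graph_order_def card_image inj_on_def)
  ultimately show "\<exists>S c0. S \<subseteq> verts H \<and> card S = graph_order G \<and> sudoku_coloring H S c0"
    using SH by blast
next
  fix m assume "\<exists>S c0. S \<subseteq> verts H \<and> card S = m \<and> sudoku_coloring H S c0"
  then obtain S c0 where "S \<subseteq> verts H" "card S = m" "sudoku_coloring H S c0"
    by blast
  then show "graph_order G \<le> m"
    using graph_order_le_sudoku[OF assms(2), folded H_def, of S c0] chi by simp
qed

section \<open>The line graph of \<open>C\<^sub>n \<circ> K\<^sub>1\<close>\<close>

definition cycle_edge :: "nat \<Rightarrow> nat \<Rightarrow> (nat + nat \<times> nat) set" where
  "cycle_edge n i = {Inl i, Inl (Suc i mod n)}"

definition pendant_edge :: "nat \<Rightarrow> (nat + nat \<times> nat) set" where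
  "pendant_edge i = {Inl i, Inr (i, 0)}"

lemma cycle_edge_ne_pendant_edge: "cycle_edge n i \<noteq> pendant_edge j"
  by (auto simp: cycle_edge_def pendant_edge_def doubleton_eq_iff)

lemma pendant_edge_eq_iff: "pendant_edge i = pendant_edge j \<longleftrightarrow> i = j"
  by (auto simp: pendant_edge_def doubleton_eq_iff)

text \<open>Two cycle edges with different indices could agree only with their ends swapped, which
  would make the cycle close after two steps, as it does for \<open>n = 2\<close>.\<close>

lemma cycle_edge_eq_iff:
  assumes "n \<ge> 3" "i < n" "j < n"
  shows "cycle_edge n i = cycle_edge n j \<longleftrightarrow> i = j"
  using assms by (auto simp: cycle_edge_def doubleton_eq_iff mod_Suc split: if_splits)

lemma edges_corona_cycle_graph:
  "edges (corona (cycle_graph n) (complete_graph 1)) =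
     cycle_edge n ` {..<n} \<union> pendant_edge ` {..<n}"
proof -
  have "{{Inl u, Inl v} | u v. {u, v} \<in> edges (cycle_graph n)} = cycle_edge n ` {..<n}"
    by (fastforce simp: cycle_graph_def cycle_edge_def image_iff doubleton_eq_iff)
  moreover have "{{Inl v, Inr (v, 0)} | v. v \<in> verts (cycle_graph n)} = pendant_edge ` {..<n}"
    by (auto simp: cycle_graph_def pendant_edge_def)
  ultimately show ?thesis
    unfolding edges_corona_complete_graph_1 by simp
qed

text \<open>Distinct pendant edges are disjoint, so one of two meeting edges is a cycle edge
  \<open>e\<^sub>i\<close>. Its partner is a pendant edge at one of its two ends or a neighboring
  cycle edge. Two neighboring cycle edges are listed under the index of the first of them in cyclic
  order.\<close>

lemma line_graph_corona_cycle_graph_edge_iff: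
  assumes "n \<ge> 3"
  shows "{x, y} \<in> edges (line_graph (corona (cycle_graph n) (complete_graph 1))) \<longleftrightarrow>
    (\<exists>i<n. {x, y} = {cycle_edge n i, cycle_edge n (Suc i mod n)} \<or>
           {x, y} = {cycle_edge n i, pendant_edge i} \<or>
           {x, y} = {cycle_edge n i, pendant_edge (Suc i mod n)})"
    (is "?L \<longleftrightarrow> (\<exists>i<n. ?R i)")
proof -
  let ?V = "cycle_edge n ` {..<n} \<union> pendant_edge ` {..<n}"
  have L: "?L \<longleftrightarrow> x \<in> ?V \<and> y \<in> ?V \<and> x \<noteq> y \<and> x \<inter> y \<noteq> {}"
    unfolding line_graph_def edges_corona_cycle_graph
    by (auto simp: doubleton_eq_iff)
  have ep: "\<exists>i<n. {cycle_edge n j, pendant_edge l} = {cycle_edge n i, pendant_edge i} \<or>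
      {cycle_edge n j, pendant_edge l} = {cycle_edge n i, pendant_edge (Suc i mod n)}"
    if "j < n" "cycle_edge n j \<inter> pendant_edge l \<noteq> {}" for j l
    using that by (auto simp: cycle_edge_def pendant_edge_def)
  have ee: "l = Suc j mod n \<or> j = Suc l mod n"
    if "j < n" "l < n" "j \<noteq> l" "cycle_edge n j \<inter> cycle_edge n l \<noteq> {}" for j l
    using that by (auto simp: cycle_edge_def mod_Suc split: if_splits)
  show ?thesis
  proof
    assume ?L
    then have xy: "x \<in> ?V" "y \<in> ?V" "x \<noteq> y" "x \<inter> y \<noteq> {}"
      using L by auto
    then consider j l where "j < n" "l < n" "x = cycle_edge n j" "y = cycle_edge n l"
      | j l where "j < n" "l < n" "x = cycle_edge n j" "y = pendant_edge l"
      | j l where "j < n" "l < n" "x = pendant_edge l" "y = cycle_edge n j"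
      | j l where "j < n" "l < n" "x = pendant_edge j" "y = pendant_edge l"
      by blast
    then show "\<exists>i<n. ?R i"
    proof cases
      case (1 j l)
      then consider "l = Suc j mod n" | "j = Suc l mod n"
        using ee[of j l] xy by auto
      then show ?thesis
      proof cases
        case 1
        then show ?thesis
          using \<open>j < n\<close> \<open>x = _\<close> \<open>y = _\<close> by auto
      next
        case 2
        then have "{x, y} = {cycle_edge n l, cycle_edge n (Suc l mod n)}"
          using \<open>x = _\<close> \<open>y = _\<close> by (simp add: insert_commute)
        then show ?thesis
          using \<open>l < n\<close> by auto
      qed
    next
      case (2 j l)
      then show ?thesis
        using ep[of j l] xy(4) by auto
    next
      case (3 j l)
      then have "{x, y} = {cycle_edge n j, pendant_edge l}" "cycle_edge n j \<inter> pendant_edge l \<noteq> {}"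
        using xy(4) by (auto simp: insert_commute Int_commute)
      then show ?thesis
        using ep[OF 3(1)] by metis
    next
      case (4 j l)
      then show ?thesis
        using xy by (auto simp: pendant_edge_def)
    qed
  next
    assume "\<exists>i<n. ?R i"
    then obtain i where i: "i < n" "?R i"
      by (elim exE conjE) (rule that)
    have s: "Suc i mod n < n" "Suc i mod n \<noteq> i"
      using i(1) assms by (auto simp: mod_Suc)
    have "cycle_edge n i \<inter> cycle_edge n (Suc i mod n) \<noteq> {}"
      "cycle_edge n i \<inter> pendant_edge i \<noteq> {}" "cycle_edge n i \<inter> pendant_edge (Suc i mod n) \<noteq> {}"
      by (auto simp: cycle_edge_def pendant_edge_def)
    moreover have "cycle_edge n i \<noteq> cycle_edge n (Suc i mod n)"
      using cycle_edge_eq_iff[OF assms i(1) s(1)] s(2) by simp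
    ultimately show ?L
      unfolding L using i s cycle_edge_ne_pendant_edge[of n i]
      by (auto simp: doubleton_eq_iff Int_commute)
  qed
qed

text \<open>Colors can be prescribed by index because the two families of edges are disjoint and
  each is enumerated injectively. The witness inverts the enumerations with \<open>THE\<close>; the
  bound \<open>i < n\<close> there is the range in which \<open>cycle_edge_eq_iff\<close> gives
  injectivity.\<close>

lemma ex_coloring_cycle_pendant:
  assumes "n \<ge> 3"
  shows "\<exists>c :: _ \<Rightarrow> nat. \<forall>i<n. c (cycle_edge n i) = a i \<and> c (pendant_edge i) = b i"
proof (intro exI allI impI conjI)
  let ?c = "\<lambda>x. if x \<in> range pendant_edge then b (THE i. x = pendant_edge i)
    else a (THE i. i < n \<and> x = cycle_edge n i)"
  fix i assume i: "i < n"
  have "(THE j. j < n \<and> cycle_edge n i = cycle_edge n j) = i"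
    using i cycle_edge_eq_iff[OF assms] by (intro the_equality) auto
  then show "?c (cycle_edge n i) = a i"
    using cycle_edge_ne_pendant_edge by auto
  show "?c (pendant_edge i) = b i"
    by (simp add: pendant_edge_eq_iff)
qed

section \<open>Explicit colors on the line graph and on the leaves\<close>

theorem mainTheorem3:
  fixes n :: nat and G :: "(nat + nat \<times> nat) set ugraph"
  assumes "n \<ge> 3"
    and "G = line_graph (corona (cycle_graph n) (complete_graph 1))"
  shows "graph_order G = 2 * n \<and>
         sudoku_number (corona G (complete_graph 1)) = 2 * n"
proof -
  let ?H = "corona G (complete_graph 1)"
  let ?e = "cycle_edge n" and ?f = pendant_edge
  have vG: "verts G = ?e ` {..<n} \<union> ?f ` {..<n}"
    unfolding assms(2) line_graph_def edges_corona_cycle_graph by simp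
  have eG: "{x, y} \<in> edges G \<longleftrightarrow> (\<exists>i<n. {x, y} = {?e i, ?e (Suc i mod n)} \<or>
      {x, y} = {?e i, ?f i} \<or> {x, y} = {?e i, ?f (Suc i mod n)})" for x y
    unfolding assms(2) by (rule line_graph_corona_cycle_graph_edge_iff[OF assms(1)])
  have simple: "simple_graph G"
    unfolding assms(2)
    by (intro simple_graph_line_graph simple_graph_corona simple_graph_cycle_graph
        simple_graph_complete_graph assms(1))
  have "card (?e ` {..<n}) = n"
    using cycle_edge_eq_iff[OF assms(1)] by (simp add: card_image inj_on_def)
  moreover have "card (?f ` {..<n}) = n"
    by (simp add: card_image inj_on_def pendant_edge_eq_iff)
  moreover have "?e ` {..<n} \<inter> ?f ` {..<n} = {}"
    using cycle_edge_ne_pendant_edge by blast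
  ultimately have order: "graph_order G = 2 * n"
    unfolding graph_order_def vG by (simp add: card_Un_disjoint)

  \<comment> \<open>The cycle edges get 3, 2, 1, 2, 1, and so on. Color 3 occurs only at
    \<open>e\<^sub>0\<close>, so the alternation closes up for either parity of
    \<open>n\<close>.\<close>
  define a :: "nat \<Rightarrow> nat" where "a i = (if i = 0 then 3 else 1 + i mod 2)" for i
  \<comment> \<open>The third color of the triangle of \<open>f\<^sub>i\<close>: for
    \<open>i = 0\<close> its other colors are 3 and \<open>a (n - 1)\<close>, which is 1 or 2; for
    \<open>i = 1\<close> they are 3 and 2; later they are 1 and 2.\<close>
  define b :: "nat \<Rightarrow> nat" where "b i = (if i = 0 then 3 - a (n - 1) else if i = 1 then 1 else 3)" for i
  obtain col where col: "\<And>i. i < n \<Longrightarrow> col (?e i) = a i" "\<And>i. i < n \<Longrightarrow> col (?f i) = b i"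
    using ex_coloring_cycle_pendant[OF assms(1), of a b] by blast
  \<comment> \<open>Forbidding 1 at \<open>e\<^sub>1\<close>, next to color 3, starts the
    alternation with 2; forbidding 3 afterwards keeps it going. The value \<open>p 0 = 1\<close> is
    a color different from \<open>a 0 = 3\<close>.\<close>
  define p :: "nat \<Rightarrow> nat" where "p i = (if i \<le> 1 then 1 else 3)" for i
  \<comment> \<open>At \<open>f\<^sub>0\<close> color 3 is forbidden so that it is forced at
    \<open>e\<^sub>0\<close>. For \<open>i \<ge> 1\<close> the value of \<open>b i\<close> is 1 or
    3, so 2 is a legal leaf color.\<close>
  define q :: "nat \<Rightarrow> nat" where "q i = (if i = 0 then 3 else 2)" for i
  obtain leaf where leaf: "\<And>i. i < n \<Longrightarrow> leaf (?e i) = p i" "\<And>i. i < n \<Longrightarrow> leaf (?f i) = q i"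
    using ex_coloring_cycle_pendant[OF assms(1), of p q] by blast

  have a_range: "a i \<in> {1..3}" for i
    by (auto simp: a_def)
  have a_last: "a (n - 1) \<in> {1, 2}"
    using assms(1) by (auto simp: a_def)
  have b_range: "b i \<in> {1..3}" for i
    using a_last by (auto simp: b_def)
  have aa: "a i \<noteq> a (Suc i mod n)" if "i < n" for i
    using that assms(1) by (auto simp: a_def mod_Suc)
  have ab: "a i \<noteq> b i" if "i < n" for i
    using a_last by (auto simp: a_def b_def)
  have ab': "a i \<noteq> b (Suc i mod n)" if "i < n" for i
  \<comment> \<open>At the wrap-around \<open>a (n - 1)\<close> is compared with
    \<open>3 - a (n - 1)\<close>; these are the two different elements of
    \<open>{1, 2}\<close>.\<close>
  proof (cases "Suc i = n")
    case True
    then show ?thesis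
      using a_last by (auto simp: b_def)
  next
    case False
    then show ?thesis
      using that by (auto simp: a_def b_def)
  qed
  have col_range: "col v \<in> {1..3}" if "v \<in> verts G" for v
    using that a_range b_range col by (auto simp: vG simp del: atLeastAtMost_iff)
  have col_proper: "col u \<noteq> col v" if uv: "{u, v} \<in> edges G" for u v
  proof -
    obtain i where i: "i < n" "{u, v} = {?e i, ?e (Suc i mod n)} \<or>
      {u, v} = {?e i, ?f i} \<or> {u, v} = {?e i, ?f (Suc i mod n)}"
      using iffD1[OF eG uv] by (elim exE conjE) (rule that)
    have "Suc i mod n < n"
      using i(1) by simp
    then show ?thesis
      using i aa[OF i(1)] ab[OF i(1)] ab'[OF i(1)] col by (auto simp: doubleton_eq_iff)
  qed
  have leaf_range: "leaf v \<in> {1..3}" if "v \<in> verts G" for v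
    using that leaf by (auto simp: vG p_def q_def)
  have leaf_col: "leaf v \<noteq> col v" if "v \<in> verts G" for v
  proof -
    have "p i \<noteq> a i" for i
      by (cases "i mod 2 = 0") (auto simp: p_def a_def)
    moreover have "q i \<noteq> b i" for i
      using a_last by (auto simp: q_def b_def)
    ultimately show ?thesis
      using that by (auto simp: vG leaf col)
  qed

  \<comment> \<open>The chromatic number of the corona\<close>
  have chi: "chromatic_number ?H = 3"
  proof (rule chromatic_number_eq_3)
    have ends: "u \<in> verts G \<and> v \<in> verts G" if "{u, v} \<in> edges G" for u v
      using simple that unfolding simple_graph_def by force
    show "proper_coloring ?H 3 (restrict (case_sum col (\<lambda>(v, _). leaf v)) (verts ?H))"
      by (rule proper_coloring_corona_case_sum)
        (fact simple col_range col_proper leaf_range leaf_col)+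
    have n: "0 < n" "1 < n" "Suc 0 mod n = 1"
      using assms(1) by auto
    \<comment> \<open>The triangle formed by the three edges at the cycle vertex 1.\<close>
    have E: "{?e 0, ?e 1} \<in> edges G" "{?e 1, ?f 1} \<in> edges G" "{?e 0, ?f 1} \<in> edges G"
      unfolding eG using n by metis+
    then show "{Inl (?e 0), Inl (?e 1)} \<in> edges ?H" "{Inl (?e 1), Inl (?f 1)} \<in> edges ?H"
      "{Inl (?e 0), Inl (?f 1)} \<in> edges ?H"
      unfolding edges_corona_complete_graph_1 by blast+
    show "Inl (?e 0) \<in> verts ?H" "Inl (?e 1) \<in> verts ?H" "Inl (?f 1) \<in> verts ?H"
      using E ends unfolding verts_corona_complete_graph_1 by blast+
  qed

  \<comment> \<open>Uniqueness of the extension\<close>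
  have "sudoku_number ?H = graph_order G"
  proof (rule sudoku_number_corona_complete_graph_1[where col = col and leaf = leaf and k = 3])
    fix d :: "(nat + nat \<times> nat) set \<Rightarrow> nat" and v
    assume d_range: "\<And>v. v \<in> verts G \<Longrightarrow> d v \<in> {1..3}"
      and d_leaf: "\<And>v. v \<in> verts G \<Longrightarrow> leaf v \<noteq> d v"
      and d_proper: "\<And>u v. {u, v} \<in> edges G \<Longrightarrow> d u \<noteq> d v"
      and v: "v \<in> verts G"
    have dr: "d (?e i) \<in> {1, 2, 3}" "d (?f i) \<in> {1, 2, 3}" if "i < n" for i
      using d_range[of "?e i"] d_range[of "?f i"] that by (auto simp: vG)
    have dl: "d (?e i) \<noteq> p i" "d (?f i) \<noteq> q i" if "i < n" for i
      using d_leaf[of "?e i"] d_leaf[of "?f i"] that by (auto simp: vG leaf)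
    have de: "d (?e i) \<noteq> d (?e (Suc i mod n))" "d (?e i) \<noteq> d (?f i)"
      "d (?e i) \<noteq> d (?f (Suc i mod n))" if "i < n" for i
      using that by (auto intro!: d_proper simp: eG)
    have last: "n - 1 < n" "Suc (n - 1) mod n = 0" "p (n - 1) = 3" "q 0 = 3"
      using assms(1) by (auto simp: p_def q_def)
    \<comment> \<open>In the triangle of \<open>e\<^sub>0\<close>, \<open>f\<^sub>0\<close> and the
      last cycle edge, the latter two avoid 3 and hence use up 1 and 2.\<close>
    have e0: "d (?e 0) = 3"
    proof -
      have "0 < n" "d (?e (n - 1)) \<noteq> 3" "d (?f 0) \<noteq> 3"
        using assms(1) dl(1)[OF last(1)] dl(2)[of 0] last by auto
      moreover have "d (?e (n - 1)) \<noteq> d (?e 0)" "d (?e (n - 1)) \<noteq> d (?f 0)"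
        using de[OF last(1)] last by auto
      ultimately show ?thesis
        using dr[of 0] dr(1)[OF last(1)] de(2)[of 0] by auto
    qed
    have e: "d (?e i) = a i" if "i < n" for i
      using that
    proof (induction i)
      case 0
      then show ?case
        using e0 by (simp add: a_def)
    next
      case (Suc i)
      \<comment> \<open>The color of the preceding cycle edge and the leaf color are two different
        excluded colors: 3 and 1 for \<open>i = 0\<close>, and \<open>a i\<close> and 3 later. One
        color is left.\<close>
      have "d (?e (Suc i)) \<noteq> a i"
        using Suc de(1)[of i] by simp
      moreover have "d (?e (Suc i)) \<noteq> p (Suc i)" "d (?e (Suc i)) \<in> {1, 2, 3}"
        using Suc.prems dl dr by auto
      ultimately show ?case
        by (cases "i mod 2 = 0") (auto simp: a_def p_def mod_Suc split: if_splits)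
    qed
    have f: "d (?f i) = b i" if "i < n" for i
    proof (cases i)
      case 0
      \<comment> \<open>The leaf color \<open>q 0 = 3\<close> excludes the second color; it equals
        the color of \<open>e\<^sub>0\<close>.\<close>
      have "d (?f 0) \<noteq> a (n - 1)"
        using de(3)[OF last(1)] last e by metis
      then show ?thesis
        using 0 that dr(2)[of 0] dl(2)[of 0] a_last by (auto simp: b_def q_def)
    next
      case (Suc j)
      have "d (?f i) \<noteq> a i" "d (?f i) \<noteq> a j"
        using de(2)[of i] de(3)[of j] e[of i] e[of j] that Suc by auto
      then show ?thesis
        using Suc dr(2)[OF that]
        by (cases "j mod 2 = 0") (auto simp: a_def b_def mod_Suc split: if_splits)
    qed
    show "d v = col v"
      using v e f col by (auto simp: vG)
  qed (fact simple chi col_range col_proper leaf_range leaf_col | simp)+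
  then show ?thesis
    using order by simp
qed

end
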